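(* Let $X$ be a real Hilbert space, let $\beta>0$, let $f\colon X\to\mathbb{R}$ be convex and $\beta$-smooth, let $g\colon X\to\left]-\infty,+\infty\right]$ be convex, lower semicontinuous and proper, and suppose that $S:=\operatorname{Argmin}(f+g)\neq\varnothing$. Let $T:=\operatorname{P}_{\frac1\beta g}\circ(\operatorname{Id}-\frac1\beta\nabla f)$ be the corresponding proximal gradient operator. Let $(t_n)_{n\in\mathbb{N}}$ be a FISTA parameter sequence, let $x_0\in X$, and let $(x_n)_{n\in\mathbb{N}}$ and $(y_n)_{n\in\mathbb{N}}$ be the FISTA sequences generated by $T$, $(t_n)_{n\in\mathbb{N}}$ and the starting point $x_0$. Suppose in addition that $T$ is affine. Then $(x_n)_{n\in\mathbb{N}}$ and $(y_n)_{n\in\mathbb{N}}$ converge strongly (in norm): $$x_n\to P_{S}x_0\quad\text{and}\quad y_n\to P_{S}x_0.$$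
   Context: $\mathbb{N}=\{0,1,2,\ldots\}$. A function $f\colon X\to\mathbb{R}$ is $\beta$-smooth if it is Fréchet differentiable with $\beta$-Lipschitz gradient $\nabla f$. $\operatorname{P}_{h}$ denotes the proximal operator of $h$: $\operatorname{P}_h(x)$ is the unique minimizer over $z\in X$ of $h(z)+\frac12\|z-x\|^2$. $\operatorname{Argmin}F$ is the set of minimizers of $F$, and $P_C$ is the metric projection onto a nonempty closed convex set $C$. A map $T\colon X\to X$ is affine if $T=L+q$ for some linear $L\colon X\to X$ and some $q\in X$. FISTA parameter sequence: a real sequence $(t_n)_{n\in\mathbb{N}}$ with $t_0=1$ such that for every $n\in\mathbb{N}$, $t_n\geq\frac{n+2}{2}$ and $t_n^2\geq t_{n+1}^2-t_{n+1}$. FISTA sequences: given $x_0\in X$, set $y_0:=x_0$ and, for every $n\in\mathbb{N}$, $x_{n+1}:=Ty_n$ and $y_{n+1}:=x_{n+1}+\frac{t_n-1}{t_{n+1}}(x_{n+1}-x_n)$. *)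

theory Defs
  imports "HOL-Analysis.Analysis"
begin

(* On a Hilbert space the Frechet derivative always has a unique Riesz representer, so the
   description below is proper at every point where f is differentiable. *)
definition gradient :: "('a::real_inner \<Rightarrow> real) \<Rightarrow> 'a \<Rightarrow> 'a" where
  "gradient f x = (THE D. GDERIV f x :> D)"

definition smooth_with :: "real \<Rightarrow> ('a::real_inner \<Rightarrow> real) \<Rightarrow> bool" where
  "smooth_with \<beta> f \<longleftrightarrow>
     (\<forall>x. f differentiable (at x)) \<and> \<beta>-lipschitz_on UNIV (gradient f)"

(* The weights are strictly positive, so a term with value infinity is never cancelled; the only
   ambiguous ereal sum, infinity plus minus infinity, does not arise for proper functions. *)
definition convex_ereal :: "('a::real_vector \<Rightarrow> ereal) \<Rightarrow> bool" where
  "convex_ereal g \<longleftrightarrow>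
     (\<forall>x y u v. 0 < u \<longrightarrow> 0 < v \<longrightarrow> u + v = 1 \<longrightarrow>
        g (u *\<^sub>R x + v *\<^sub>R y) \<le> ereal u * g x + ereal v * g y)"

definition lower_semicontinuous :: "('a::topological_space \<Rightarrow> ereal) \<Rightarrow> bool" where
  "lower_semicontinuous g \<longleftrightarrow> (\<forall>x. g x \<le> Liminf (nhds x) g)"

definition proper_fun :: "('a \<Rightarrow> ereal) \<Rightarrow> bool" where
  "proper_fun g \<longleftrightarrow> (\<forall>x. g x \<noteq> -\<infinity>) \<and> (\<exists>x. g x \<noteq> \<infinity>)"

definition Argmin :: "('a \<Rightarrow> ereal) \<Rightarrow> 'a set" where
  "Argmin F = {x. \<forall>z. F x \<le> F z}"

definition prox :: "('a::real_inner \<Rightarrow> ereal) \<Rightarrow> 'a \<Rightarrow> 'a" where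
  "prox h x = (THE p. p \<in> Argmin (\<lambda>z. h z + ereal (1/2 * (norm (z - x))\<^sup>2)))"

(* The library's closest_point is only available for types of class heine_borel, that is,
   in finite dimension. *)
definition metric_proj :: "'a::metric_space set \<Rightarrow> 'a \<Rightarrow> 'a" where
  "metric_proj C x = (THE p. p \<in> C \<and> (\<forall>c\<in>C. dist x p \<le> dist x c))"

definition prox_grad ::
    "real \<Rightarrow> ('a::real_inner \<Rightarrow> real) \<Rightarrow> ('a \<Rightarrow> ereal) \<Rightarrow> 'a \<Rightarrow> 'a" where
  "prox_grad \<beta> f g =
     prox (\<lambda>z. ereal (1/\<beta>) * g z) \<circ> (\<lambda>x. x - (1/\<beta>) *\<^sub>R gradient f x)"

definition affine_map :: "('a::real_vector \<Rightarrow> 'a) \<Rightarrow> bool" where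
  "affine_map T \<longleftrightarrow> (\<exists>L q. linear L \<and> T = (\<lambda>x. L x + q))"

definition fista_parameters :: "(nat \<Rightarrow> real) \<Rightarrow> bool" where
  "fista_parameters t \<longleftrightarrow> t 0 = 1 \<and>
     (\<forall>n. t n \<ge> (real n + 2) / 2 \<and> (t n)\<^sup>2 \<ge> (t (Suc n))\<^sup>2 - t (Suc n))"

definition fista_sequences ::
    "('a::real_vector \<Rightarrow> 'a) \<Rightarrow> (nat \<Rightarrow> real) \<Rightarrow> 'a \<Rightarrow> (nat \<Rightarrow> 'a) \<Rightarrow> (nat \<Rightarrow> 'a) \<Rightarrow> bool" where
  "fista_sequences T t x0 x y \<longleftrightarrow> x 0 = x0 \<and> y 0 = x0 \<and>
     (\<forall>n. x (Suc n) = T (y n) \<and>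
          y (Suc n) = x (Suc n) + ((t n - 1) / t (Suc n)) *\<^sub>R (x (Suc n) - x n))"

end

(* Write F = f + g. The energy
     t_n^2 (F(x_(n+1)) - min F) + (beta/2) |t_n x_(n+1) - (t_n - 1) x_n - p|^2
   is nonincreasing for every minimizer p. Hence |x_n - p| <= |x_0 - p| for all n, and
   F(x_n) -> min F, which forces x_n - T x_n -> 0.
   Let T (p + u) = p + L u. The minimizers are p + Fix L, and L is nonexpansive, so Fix L is the
   orthogonal complement of ran (Id - L); choose p with x_0 - p in the closure of ran (Id - L).
   The FISTA iteration of L is a polynomial in L applied to its starting point: started at z - L z
   it produces u_n - L u_n, where u_n starts at z, and this tends to 0. The uniform bound on the
   iterates extends the convergence to starting points in the closure. *)
theory Submission
  imports Defs
begin

section \<open>Minimizers of prox objectives\<close>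

text \<open>Adds the zero weights that \<open>convex_ereal\<close> leaves out; with finite values at
  both points these cases are trivial. Segments can then be parametrized up to their
  endpoints.\<close>

lemma convex_erealD:
  assumes "convex_ereal h" "h a = ereal r" "h b = ereal s" "0 \<le> u" "0 \<le> v" "u + v = 1"
  shows "h (u *\<^sub>R a + v *\<^sub>R b) \<le> ereal (u * r + v * s)"
proof (cases "u = 0 \<or> v = 0")
  case True
  then show ?thesis using assms by auto
next
  case False
  then have "h (u *\<^sub>R a + v *\<^sub>R b) \<le> ereal u * h a + ereal v * h b"
    using assms unfolding convex_ereal_def by (metis less_eq_real_def)
  then show ?thesis using assms(2,3) by simp
qed

text \<open>The parallelogram law for \<open>a - x\<close> and \<open>b - x\<close>.\<close>

lemma midpoint_norm_sq:
  fixes a b x :: "'a::real_inner"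
  shows "(norm ((1/2) *\<^sub>R a + (1/2) *\<^sub>R b - x))\<^sup>2
    = (norm (a - x))\<^sup>2 / 2 + (norm (b - x))\<^sup>2 / 2 - (norm (a - b))\<^sup>2 / 4"
  unfolding power2_norm_eq_inner
  by (simp add: algebra_simps inner_commute field_simps)

text \<open>Strong convexity of the prox objective: its value at the midpoint is still at least
  \<open>m\<close>, yet lies below the average of the values at \<open>a\<close> and
  \<open>b\<close> by \<open>(norm (a - b))\<^sup>2 / 8\<close>. Near-minimizers are therefore close
  to each other.\<close>

lemma prox_objective_gap:
  fixes h :: "'a::real_inner \<Rightarrow> ereal"
  assumes "convex_ereal h" "h a = ereal r" "h b = ereal s"
    and "\<And>z. ereal m \<le> h z + ereal (1/2 * (norm (z - x))\<^sup>2)"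
  shows "(norm (a - b))\<^sup>2 \<le>
    4 * ((r + 1/2 * (norm (a - x))\<^sup>2 - m) + (s + 1/2 * (norm (b - x))\<^sup>2 - m))"
proof -
  let ?c = "(1/2) *\<^sub>R a + (1/2) *\<^sub>R b"
  have "h ?c \<le> ereal (1/2 * r + 1/2 * s)"
    using convex_erealD[OF assms(1-3), of "1/2" "1/2"] by simp
  then have "h ?c + ereal (1/2 * (norm (?c - x))\<^sup>2)
      \<le> ereal (1/2 * r + 1/2 * s) + ereal (1/2 * (norm (?c - x))\<^sup>2)"
    by (rule add_right_mono)
  then have "ereal m \<le> ereal (1/2 * r + 1/2 * s) + ereal (1/2 * (norm (?c - x))\<^sup>2)"
    using assms(4)[of ?c] order_trans by blast
  then have "m \<le> 1/2 * r + 1/2 * s + 1/2 * (norm (?c - x))\<^sup>2" by simp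
  then show ?thesis unfolding midpoint_norm_sq by argo
qed

text \<open>The direct method: the gap estimate makes a minimizing sequence Cauchy, completeness
  gives its limit, and lower semicontinuity shows that the limit is a minimizer. The Riesz
  representer and the projection onto a closed convex set are obtained from it as well.\<close>

lemma prox_objective_minimizer_exists:
  fixes h :: "'a::{real_inner,complete_space} \<Rightarrow> ereal"
  assumes cvx: "convex_ereal h" and lsc: "lower_semicontinuous h" and prp: "proper_fun h"
    and bdd: "\<And>z. ereal m \<le> h z + ereal (1/2 * (norm (z - x))\<^sup>2)"
  obtains p where "p \<in> Argmin (\<lambda>z. h z + ereal (1/2 * (norm (z - x))\<^sup>2))"
proof -
  define \<phi> where "\<phi> = (\<lambda>z. h z + ereal (1/2 * (norm (z - x))\<^sup>2))"
  obtain z0 where "h z0 \<noteq> \<infinity>" using prp unfolding proper_fun_def by auto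
  then have z0: "\<phi> z0 \<noteq> \<infinity>" unfolding \<phi>_def by simp
  define M where "M = (INF z. \<phi> z)"
  have "ereal m \<le> M" unfolding M_def \<phi>_def by (rule INF_greatest) (rule bdd)
  moreover have "M \<le> \<phi> z0" unfolding M_def by (rule INF_lower) simp
  ultimately obtain \<mu> where \<mu>: "M = ereal \<mu>" using z0 by (cases M) auto
  have low: "ereal \<mu> \<le> \<phi> z" for z unfolding \<mu>[symmetric] M_def by (rule INF_lower) simp
  have "\<exists>z. \<phi> z < ereal (\<mu> + inverse (real (Suc n)))" for n
  proof -
    have "M < ereal (\<mu> + inverse (real (Suc n)))" unfolding \<mu> by simp
    then show ?thesis unfolding M_def by (auto simp: INF_less_iff)
  qed
  then obtain z where z: "\<And>n. \<phi> (z n) < ereal (\<mu> + inverse (real (Suc n)))" by metis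
  have "\<exists>r. h (z n) = ereal r" for n
    using prp z[of n] unfolding proper_fun_def \<phi>_def by (cases "h (z n)") auto
  then obtain r where r: "\<And>n. h (z n) = ereal (r n)" by metis
  have rz: "r n + 1/2 * (norm (z n - x))\<^sup>2 < \<mu> + inverse (real (Suc n))" for n
    using z[of n] r[of n] unfolding \<phi>_def by simp
  have gap: "(norm (z i - z j))\<^sup>2 \<le> 4 * (inverse (real (Suc i)) + inverse (real (Suc j)))" for i j
    using prox_objective_gap[OF cvx r r low[unfolded \<phi>_def], of i j] rz[of i] rz[of j] by simp
  have "Cauchy z"
  proof (rule metric_CauchyI)
    fix e :: real assume "0 < e"
    \<comment> \<open>The gap estimate multiplies a sum of two reciprocals by 4, hence the factor
      8.\<close>
    then obtain N where N: "inverse (real (Suc N)) < e\<^sup>2 / 8"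
      using reals_Archimedean[of "e\<^sup>2 / 8"] by auto
    have "dist (z i) (z j) < e" if "i \<ge> N" "j \<ge> N" for i j
    proof -
      have "inverse (real (Suc i)) \<le> inverse (real (Suc N))"
           "inverse (real (Suc j)) \<le> inverse (real (Suc N))" using that by auto
      moreover have "d < E" if "d \<le> 4 * (a + b)" "a \<le> c" "b \<le> c" "c < E / 8" for a b c d E :: real
        using that by (simp add: field_simps)
      ultimately have "(norm (z i - z j))\<^sup>2 < e\<^sup>2" using gap[of i j] N by blast
      then show ?thesis unfolding dist_norm using \<open>0 < e\<close> by (simp add: power2_less_imp_less)
    qed
    then show "\<exists>N. \<forall>i\<ge>N. \<forall>j\<ge>N. dist (z i) (z j) < e" by blast
  qed
  then obtain p where p: "z \<longlonglongrightarrow> p" using Cauchy_convergent convergent_def by metis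
  have lim: "(\<lambda>n. \<mu> + inverse (real (Suc n)) - 1/2 * (norm (z n - x))\<^sup>2)
      \<longlonglongrightarrow> \<mu> + 0 - 1/2 * (norm (p - x))\<^sup>2"
    by (intro tendsto_intros p LIMSEQ_inverse_real_of_nat)
  \<comment> \<open>Any \<open>c\<close> below \<open>h p\<close> is eventually below
    \<open>h (z n)\<close> by lower semicontinuity, hence below the upper bounds of
    \<open>h (z n)\<close> and below their limit. This also rules out
    \<open>h p = \<infinity>\<close>.\<close>
  have "h p \<le> ereal (\<mu> - 1/2 * (norm (p - x))\<^sup>2)"
  proof (rule dense_le)
    fix c assume "c < h p"
    then have "c < Liminf (nhds p) h" using lsc unfolding lower_semicontinuous_def
      using order_less_le_trans by blast
    then have "eventually (\<lambda>w. c < h w) (nhds p)" by (rule less_LiminfD)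
    then have ev: "eventually (\<lambda>n. c < h (z n)) sequentially"
      using p unfolding filterlim_def le_filter_def eventually_filtermap by auto
    have "eventually (\<lambda>n. c \<le> ereal (\<mu> + inverse (real (Suc n)) - 1/2 * (norm (z n - x))\<^sup>2)) sequentially"
      using ev
    proof (rule eventually_mono)
      fix n assume "c < h (z n)"
      moreover have "h (z n) \<le> ereal (\<mu> + inverse (real (Suc n)) - 1/2 * (norm (z n - x))\<^sup>2)"
        using rz[of n] r[of n] by simp
      ultimately show "c \<le> ereal (\<mu> + inverse (real (Suc n)) - 1/2 * (norm (z n - x))\<^sup>2)" by simp
    qed
    moreover have "(\<lambda>n. ereal (\<mu> + inverse (real (Suc n)) - 1/2 * (norm (z n - x))\<^sup>2))
      \<longlonglongrightarrow> ereal (\<mu> - 1/2 * (norm (p - x))\<^sup>2)" using lim by (intro tendsto_ereal) simp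
    ultimately show "c \<le> ereal (\<mu> - 1/2 * (norm (p - x))\<^sup>2)"
      by (intro tendsto_lowerbound) auto
  qed
  then have "\<phi> p \<le> ereal \<mu>" unfolding \<phi>_def by (cases "h p") auto
  then have "p \<in> Argmin \<phi>" using low unfolding Argmin_def by (auto intro: order_trans)
  then show thesis using that unfolding \<phi>_def by blast
qed

section \<open>First-order conditions at minimizers\<close>

text \<open>Divide by \<open>s\<close> and let it decrease to 0: the second-order remainder
  disappears. All variational inequalities below are read off in this way.\<close>

lemma ge_of_perturbation:
  fixes a b c :: real
  assumes "\<And>s. 0 < s \<Longrightarrow> s \<le> 1 \<Longrightarrow> s * a \<le> s * b + s\<^sup>2 * c"
  shows "a \<le> b"
proof -
  have "\<forall>\<^sub>F s in at_right 0. a \<le> b + s * c"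
    unfolding eventually_at_right_field
  proof (intro exI[of _ 1] conjI allI impI)
    fix s :: real assume "0 < s" "s < 1"
    then have "s * a \<le> s * (b + s * c)"
      using assms[of s] by (simp add: power2_eq_square algebra_simps)
    then show "a \<le> b + s * c" using \<open>0 < s\<close> by simp
  qed simp
  moreover have "((\<lambda>s. b + s * c) \<longlongrightarrow> b + 0 * c) (at_right 0)"
    by (intro tendsto_intros)
  ultimately show ?thesis using tendsto_lowerbound[of _ "b + 0 * c" "at_right 0" a]
    by (metis add.right_neutral mult_zero_left trivial_limit_at_right_real)
qed

text \<open>Fermat's rule: \<open>- D\<close> is a subgradient of \<open>h\<close> at
  \<open>p\<close>. Compare \<open>p\<close> with points of the segment to \<open>z\<close>;
  convexity of \<open>h\<close> and the quadratic upper model of \<open>\<phi>\<close> leave an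
  inequality whose linear part in \<open>s\<close> is the claim. It serves both for the squared
  distance and for a smooth \<open>f\<close>.\<close>

lemma Argmin_sum_subgradient:
  fixes h :: "'a::real_inner \<Rightarrow> ereal" and \<phi> :: "'a \<Rightarrow> real"
  assumes cvx: "convex_ereal h" and prp: "proper_fun h"
    and p: "p \<in> Argmin (\<lambda>z. h z + ereal (\<phi> z))"
    and up: "\<And>z. \<phi> z \<le> \<phi> p + D \<bullet> (z - p) + C * (norm (z - p))\<^sup>2"
  obtains r where "h p = ereal r" "\<And>z. ereal (r - D \<bullet> (z - p)) \<le> h z"
proof -
  obtain z0 where z0: "h z0 \<noteq> \<infinity>" using prp unfolding proper_fun_def by auto
  have ninf: "h z \<noteq> -\<infinity>" for z using prp unfolding proper_fun_def by auto
  have min: "h p + ereal (\<phi> p) \<le> h z + ereal (\<phi> z)" for z using p unfolding Argmin_def by auto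
  obtain r where r: "h p = ereal r"
    using z0 ninf[of p] min[of z0] by (cases "h p"; cases "h z0") auto
  have "ereal (r - D \<bullet> (z - p)) \<le> h z" for z
  proof (cases "h z")
    case (real c)
    have "r - c \<le> D \<bullet> (z - p)"
    proof (rule ge_of_perturbation)
      fix s :: real assume s: "0 < s" "s \<le> 1"
      let ?w = "(1 - s) *\<^sub>R p + s *\<^sub>R z"
      have w: "?w - p = s *\<^sub>R (z - p)" by (simp add: algebra_simps)
      have "h ?w \<le> ereal ((1 - s) * r + s * c)"
        using convex_erealD[OF cvx r real, of "1 - s" s] s by simp
      then have "h ?w + ereal (\<phi> ?w) \<le> ereal ((1 - s) * r + s * c) + ereal (\<phi> ?w)"
        by (rule add_right_mono)
      then have "r + \<phi> p \<le> (1 - s) * r + s * c + \<phi> ?w"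
        using min[of ?w] r by (metis ereal_less_eq(3) order_trans plus_ereal.simps(1))
      moreover have "\<phi> ?w \<le> \<phi> p + s * (D \<bullet> (z - p)) + s\<^sup>2 * (C * (norm (z - p))\<^sup>2)"
        using up[of ?w] unfolding w by (simp add: power_mult_distrib mult.left_commute)
      ultimately show "s * (r - c) \<le> s * (D \<bullet> (z - p)) + s\<^sup>2 * (C * (norm (z - p))\<^sup>2)"
        by (simp add: algebra_simps)
    qed
    then show ?thesis using real by simp
  qed (use ninf in auto)
  then show thesis using r that by blast
qed

text \<open>For half the squared distance the quadratic model is exact, with
  \<open>D = p - x\<close>; so \<open>x - p\<close> is a subgradient of \<open>h\<close> at
  \<open>p\<close>.\<close>

lemma prox_objective_subgradient:
  fixes h :: "'a::real_inner \<Rightarrow> ereal"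
  assumes "convex_ereal h" "proper_fun h"
    and "p \<in> Argmin (\<lambda>z. h z + ereal (1/2 * (norm (z - x))\<^sup>2))"
  obtains r where "h p = ereal r" "\<And>z. ereal (r + (x - p) \<bullet> (z - p)) \<le> h z"
proof -
  have "1/2 * (norm (z - x))\<^sup>2
      \<le> 1/2 * (norm (p - x))\<^sup>2 + (p - x) \<bullet> (z - p) + 1/2 * (norm (z - p))\<^sup>2" for z
    unfolding power2_norm_eq_inner by (simp add: algebra_simps inner_commute)
  then obtain r where "h p = ereal r" "\<And>z. ereal (r - (p - x) \<bullet> (z - p)) \<le> h z"
    using Argmin_sum_subgradient[OF assms] by metis
  then show thesis using that[of r] by (simp add: inner_diff_left algebra_simps)
qed

text \<open>The description in \<open>prox\<close> needs uniqueness, which is monotonicity of the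
  subdifferential: adding the subgradient inequalities at \<open>p\<close> and \<open>q\<close>
  gives \<open>(q - p) \<bullet> (q - p) \<le> 0\<close>.\<close>

lemma prox_eqI:
  fixes h :: "'a::real_inner \<Rightarrow> ereal"
  assumes cvx: "convex_ereal h" and prp: "proper_fun h"
    and p: "p \<in> Argmin (\<lambda>z. h z + ereal (1/2 * (norm (z - x))\<^sup>2))"
  shows "prox h x = p"
  unfolding prox_def
proof (rule the_equality)
  show "p \<in> Argmin (\<lambda>z. h z + ereal (1/2 * (norm (z - x))\<^sup>2))" by (fact p)
next
  fix q assume q: "q \<in> Argmin (\<lambda>z. h z + ereal (1/2 * (norm (z - x))\<^sup>2))"
  obtain r where r: "h p = ereal r" "\<And>z. ereal (r + (x - p) \<bullet> (z - p)) \<le> h z"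
    using prox_objective_subgradient[OF cvx prp p] by blast
  obtain s where s: "h q = ereal s" "\<And>z. ereal (s + (x - q) \<bullet> (z - q)) \<le> h z"
    using prox_objective_subgradient[OF cvx prp q] by blast
  have "(x - p) \<bullet> (q - p) + (x - q) \<bullet> (p - q) \<le> 0"
    using r(2)[of q] s(2)[of p] r(1) s(1) by simp
  then have "(q - p) \<bullet> (q - p) \<le> 0" by (simp add: algebra_simps inner_commute)
  then show "q = p" using inner_ge_zero[of "q - p"] by (metis antisym inner_eq_zero_iff right_minus_eq)
qed

text \<open>The representer is the minimizer of \<open>1/2 * (norm z)\<^sup>2 - l z\<close>. Its
  subgradient inequality reads \<open>l w \<le> p \<bullet> w\<close>, and applying this to
  \<open>w\<close> and \<open>- w\<close> gives equality.\<close>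

lemma riesz_representation:
  fixes l :: "'a::{real_inner,complete_space} \<Rightarrow> real"
  assumes "bounded_linear l"
  obtains a where "\<And>z. l z = z \<bullet> a"
proof -
  interpret l: bounded_linear l by fact
  let ?h = "\<lambda>z. ereal (- l z)"
  have "convex_ereal ?h"
    unfolding convex_ereal_def by (auto simp: l.add l.scaleR)
  moreover have "lower_semicontinuous ?h"
    unfolding lower_semicontinuous_def
  proof
    fix z
    have "(?h \<longlongrightarrow> ?h z) (nhds z)"
      by (intro tendsto_intros l.tendsto filterlim_ident)
    then show "?h z \<le> Liminf (nhds z) ?h"
      by (subst lim_imp_Liminf) (auto simp: nhds_neq_bot)
  qed
  moreover have "proper_fun ?h" unfolding proper_fun_def by simp
  moreover obtain K where K: "\<And>z. norm (l z) \<le> norm z * K" using l.bounded by blast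
  \<comment> \<open>Since \<open>l z \<le> norm z * K\<close>, completing the square in
    \<open>norm z\<close> bounds the objective below.\<close>
  have "- K\<^sup>2 / 2 \<le> - l z + 1/2 * (norm (z - 0))\<^sup>2" for z
  proof -
    have "0 \<le> (norm z - K)\<^sup>2" by simp
    then show ?thesis using K[of z] by (simp add: power2_diff)
  qed
  then have "ereal (- K\<^sup>2 / 2) \<le> ?h z + ereal (1/2 * (norm (z - 0))\<^sup>2)" for z by simp
  ultimately obtain p where p: "p \<in> Argmin (\<lambda>z. ?h z + ereal (1/2 * (norm (z - 0))\<^sup>2))"
    by (rule prox_objective_minimizer_exists)
  obtain r where r: "?h p = ereal r" "\<And>z. ereal (r + (0 - p) \<bullet> (z - p)) \<le> ?h z"
    using prox_objective_subgradient[OF \<open>convex_ereal ?h\<close> \<open>proper_fun ?h\<close> p] by blast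
  have le: "l w \<le> p \<bullet> w" for w
    using r(1) r(2)[of "p + w"] by (simp add: l.add)
  have "l z = z \<bullet> p" for z using le[of z] le[of "- z"] l.scaleR[of "-1" z] by (simp add: inner_commute)
  then show thesis by (rule that)
qed

section \<open>The proximal gradient inequality\<close>

lemma GDERIV_unique:
  fixes f :: "'a::real_inner \<Rightarrow> real"
  assumes "GDERIV f x :> D" "GDERIV f x :> E"
  shows "D = E"
proof -
  have "(\<lambda>h. h \<bullet> D) = (\<lambda>h. h \<bullet> E)"
    using assms unfolding gderiv_def by (rule has_derivative_unique)
  then have "(D - E) \<bullet> D = (D - E) \<bullet> E" by metis
  then have "(D - E) \<bullet> (D - E) = 0" by (simp add: inner_diff_right)
  then show ?thesis by simp
qed

text \<open>Completeness enters through the Riesz representer, which makes the description in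
  \<open>gradient\<close> meaningful.\<close>

lemma GDERIV_gradient:
  fixes f :: "'a::{real_inner,complete_space} \<Rightarrow> real"
  assumes "f differentiable (at x)"
  shows "GDERIV f x :> gradient f x"
proof -
  obtain l where l: "(f has_derivative l) (at x)" using assms unfolding differentiable_def by blast
  obtain D where "\<And>z. l z = z \<bullet> D"
    using riesz_representation[OF has_derivative_bounded_linear[OF l]] by blast
  then have "l = (\<lambda>z. z \<bullet> D)" by auto
  then have "GDERIV f x :> D" using l unfolding gderiv_def by simp
  then show ?thesis unfolding gradient_def using GDERIV_unique theI by metis
qed

text \<open>The descent lemma. Along the segment from \<open>y\<close> to \<open>z\<close>,
  \<open>f\<close> minus its quadratic model has nonpositive derivative by Cauchy-Schwarz and the
  Lipschitz bound. A general gradient map \<open>D\<close> allows the application to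
  \<open>- f\<close> as well.\<close>

lemma GDERIV_lipschitz_upper_bound:
  fixes f :: "'a::real_inner \<Rightarrow> real"
  assumes D: "\<And>x. GDERIV f x :> D x"
    and lip: "\<And>x y. norm (D x - D y) \<le> \<beta> * norm (x - y)"
  shows "f z \<le> f y + D y \<bullet> (z - y) + \<beta> / 2 * (norm (z - y))\<^sup>2"
proof -
  let ?d = "z - y"
  define k where "k = (\<lambda>s. f (y + s *\<^sub>R ?d))"
  define \<phi> where "\<phi> = (\<lambda>s. k s - s * (D y \<bullet> ?d) - \<beta> / 2 * s\<^sup>2 * (norm ?d)\<^sup>2)"
  have "\<phi> 1 \<le> \<phi> 0"
  proof (rule DERIV_nonpos_imp_nonincreasing[of 0 1 \<phi>])
    fix s :: real assume "0 \<le> s" "s \<le> 1"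
    let ?e = "D (y + s *\<^sub>R ?d) - D y"
    have "(k has_derivative (\<lambda>h. (h *\<^sub>R ?d) \<bullet> D (y + s *\<^sub>R ?d))) (at s)"
      using D[of "y + s *\<^sub>R ?d"] unfolding gderiv_def k_def
      by (rule has_derivative_compose[rotated]) (auto intro!: derivative_eq_intros)
    then have "DERIV k s :> ?d \<bullet> D (y + s *\<^sub>R ?d)"
      unfolding has_field_derivative_def by (simp add: mult.commute[of _ "_ \<bullet> _"])
    then have deriv: "DERIV \<phi> s :> ?d \<bullet> D (y + s *\<^sub>R ?d) - D y \<bullet> ?d - \<beta> * s * (norm ?d)\<^sup>2"
      unfolding \<phi>_def by (auto intro!: derivative_eq_intros)
    have "?e \<bullet> ?d \<le> norm ?e * norm ?d" by (rule norm_cauchy_schwarz)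
    moreover have "norm ?e * norm ?d \<le> (\<beta> * (s * norm ?d)) * norm ?d"
      using lip[of "y + s *\<^sub>R ?d" y] \<open>0 \<le> s\<close> by (intro mult_right_mono) auto
    ultimately have "?d \<bullet> D (y + s *\<^sub>R ?d) - D y \<bullet> ?d - \<beta> * s * (norm ?d)\<^sup>2 \<le> 0"
      by (simp add: power2_eq_square inner_diff_left[of "D _" "D _"] inner_commute[of ?d] mult.assoc)
    then show "\<exists>d. DERIV \<phi> s :> d \<and> d \<le> 0" using deriv by blast
  qed simp
  then show ?thesis unfolding \<phi>_def k_def by simp
qed

lemma smooth_withD:
  fixes f :: "'a::{real_inner,complete_space} \<Rightarrow> real"
  assumes "smooth_with \<beta> f"
  shows "GDERIV f x :> gradient f x"
    and "norm (gradient f x - gradient f y) \<le> \<beta> * norm (x - y)"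
  using assms GDERIV_gradient lipschitz_onD[of \<beta> UNIV "gradient f" x y]
  unfolding smooth_with_def by (auto simp: dist_norm)

lemmas smooth_with_upper_bound =
  GDERIV_lipschitz_upper_bound[OF smooth_withD(1) smooth_withD(2)]

text \<open>The descent lemma for \<open>- f\<close> bounds \<open>f\<close> from below near
  \<open>y\<close> up to second order; convexity bounds it from above on the segment to
  \<open>z\<close>. Comparing the linear parts gives the tangent inequality.\<close>

lemma convex_gradient_inequality:
  fixes f :: "'a::{real_inner,complete_space} \<Rightarrow> real"
  assumes cvx: "convex_on UNIV f" and sm: "smooth_with \<beta> f"
  shows "f y + gradient f y \<bullet> (z - y) \<le> f z"
proof -
  have low: "- f w \<le> - f y + (- gradient f y) \<bullet> (w - y) + \<beta> / 2 * (norm (w - y))\<^sup>2" for w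
  proof (rule GDERIV_lipschitz_upper_bound)
    show "GDERIV (\<lambda>x. - f x) x :> - gradient f x" for x
      by (intro GDERIV_minus smooth_withD(1)[OF sm])
    show "norm (- gradient f x - - gradient f y) \<le> \<beta> * norm (x - y)" for x y
      using smooth_withD(2)[OF sm, of y x] by (simp add: norm_minus_commute)
  qed
  have "gradient f y \<bullet> (z - y) \<le> f z - f y"
  proof (rule ge_of_perturbation)
    fix s :: real assume s: "0 < s" "s \<le> 1"
    define w where "w = (1 - s) *\<^sub>R y + s *\<^sub>R z"
    have w: "w - y = s *\<^sub>R (z - y)" unfolding w_def by (simp add: algebra_simps)
    have "f w \<le> (1 - s) * f y + s * f z"
      unfolding w_def using convex_onD[OF cvx, of s y z] s by simp
    moreover have "- f w \<le> - f y - s * (gradient f y \<bullet> (z - y))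
        + s\<^sup>2 * (\<beta> / 2 * (norm (z - y))\<^sup>2)"
      using low[of w] unfolding w by (simp add: power_mult_distrib mult.left_commute)
    ultimately show "s * (gradient f y \<bullet> (z - y))
        \<le> s * (f z - f y) + s\<^sup>2 * (\<beta> / 2 * (norm (z - y))\<^sup>2)"
      by (simp add: left_diff_distrib right_diff_distrib)
  qed
  then show ?thesis by simp
qed

section \<open>Scaling and sums of extended-valued functions\<close>

lemma convex_ereal_cmult:
  assumes "convex_ereal h" "0 \<le> c"
  shows "convex_ereal (\<lambda>z. ereal c * h z)"
  unfolding convex_ereal_def
proof (intro allI impI)
  fix x y :: 'a and u v :: real assume uv: "0 < u" "0 < v" "u + v = 1"
  then have "ereal c * h (u *\<^sub>R x + v *\<^sub>R y) \<le> ereal c * (ereal u * h x + ereal v * h y)"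
    using assms unfolding convex_ereal_def by (intro ereal_mult_left_mono) auto
  also have "\<dots> = ereal u * (ereal c * h x) + ereal v * (ereal c * h y)"
    by (simp add: distrib_left_ereal_nn[OF \<open>0 \<le> c\<close>] mult.commute[of "ereal c"] mult.assoc)
  finally show "ereal c * h (u *\<^sub>R x + v *\<^sub>R y) \<le> ereal u * (ereal c * h x) + ereal v * (ereal c * h y)" .
qed

lemma lower_semicontinuous_cmult:
  assumes "lower_semicontinuous h" "0 \<le> c"
  shows "lower_semicontinuous (\<lambda>z. ereal c * h z)"
  using assms unfolding lower_semicontinuous_def
  by (auto simp: Liminf_ereal_mult_left intro!: ereal_mult_left_mono)

lemma proper_fun_cmult:
  assumes "proper_fun h" "0 < c"
  shows "proper_fun (\<lambda>z. ereal c * h z)"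
  using assms unfolding proper_fun_def by (auto simp: ereal_mult_eq_MInfty ereal_mult_eq_PInfty)

lemma convex_ereal_add_real:
  assumes "convex_on UNIV f" "convex_ereal g" "proper_fun g"
  shows "convex_ereal (\<lambda>z. ereal (f z) + g z)"
  unfolding convex_ereal_def
proof (intro allI impI)
  fix x y :: 'a and u v :: real assume uv: "0 < u" "0 < v" "u + v = 1"
  let ?w = "u *\<^sub>R x + v *\<^sub>R y"
  have f: "ereal (f ?w) \<le> ereal (u * f x + v * f y)"
    using assms(1) uv unfolding convex_on_def by auto
  have g: "g ?w \<le> ereal u * g x + ereal v * g y"
    using assms(2) uv unfolding convex_ereal_def by blast
  have "g x \<noteq> -\<infinity>" "g y \<noteq> -\<infinity>" using assms(3) unfolding proper_fun_def by auto
  then have "ereal u * (ereal (f x) + g x) + ereal v * (ereal (f y) + g y)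
      = ereal (u * f x + v * f y) + (ereal u * g x + ereal v * g y)"
    using uv by (cases "g x"; cases "g y") (auto simp: algebra_simps)
  then show "ereal (f ?w) + g ?w \<le> ereal u * (ereal (f x) + g x) + ereal v * (ereal (f y) + g y)"
    using add_mono[OF f g] by simp
qed

lemma ereal_le_add_real:
  assumes "ereal u \<le> H" "m \<le> u + r"
  shows "ereal m \<le> H + ereal r"
  using assms by (cases H) auto

text \<open>A minimizer of \<open>f + g\<close> yields an affine minorant of \<open>g\<close>, so that the prox objective is
  bounded below without an appeal to the Hahn-Banach theorem.\<close>
lemma prox_grad_minimizer_subgradient:
  fixes f :: "'a::{real_inner,complete_space} \<Rightarrow> real"
  assumes "0 < \<beta>" and cvx: "convex_on UNIV f" and sm: "smooth_with \<beta> f"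
    and g: "convex_ereal g" "lower_semicontinuous g" "proper_fun g"
    and argmin: "Argmin (\<lambda>z. ereal (f z) + g z) \<noteq> {}"
  obtains r where "g (prox_grad \<beta> f g y) = ereal r"
    "\<And>z. ereal (r + \<beta> * ((y - (1/\<beta>) *\<^sub>R gradient f y - prox_grad \<beta> f g y) \<bullet> (z - prox_grad \<beta> f g y))) \<le> g z"
proof -
  define h where "h = (\<lambda>z. ereal (1/\<beta>) * g z)"
  have h: "convex_ereal h" "lower_semicontinuous h" "proper_fun h"
    unfolding h_def using g \<open>0 < \<beta>\<close>
    by (auto intro: convex_ereal_cmult lower_semicontinuous_cmult proper_fun_cmult)
  obtain q where q: "q \<in> Argmin (\<lambda>z. g z + ereal (f z))" using argmin by (auto simp: add.commute)
  obtain c where c: "g q = ereal c" "\<And>z. ereal (c - gradient f q \<bullet> (z - q)) \<le> g z"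
    using Argmin_sum_subgradient[OF g(1,3) q smooth_with_upper_bound[OF sm sm]] by metis
  define x where "x = y - (1/\<beta>) *\<^sub>R gradient f y"
  define v where "v = (1/\<beta>) *\<^sub>R gradient f q"
  have "ereal (c / \<beta> - v \<bullet> (x - q) - (norm v)\<^sup>2 / 2) \<le> h z + ereal (1/2 * (norm (z - x))\<^sup>2)" for z
  proof -
    have "ereal (1/\<beta>) * ereal (c - gradient f q \<bullet> (z - q)) \<le> h z"
      unfolding h_def using c(2)[of z] \<open>0 < \<beta>\<close> by (intro ereal_mult_left_mono) auto
    then have "ereal (c / \<beta> - v \<bullet> (z - q)) \<le> h z"
      unfolding v_def by (simp add: diff_divide_distrib)
    \<comment> \<open>Completing the square:
      \<open>1/2 * (norm (z - x))\<^sup>2 - v \<bullet> (z - x)\<close> is least when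
      \<open>z - x = v\<close>.\<close>
    moreover have "c / \<beta> - v \<bullet> (x - q) - (norm v)\<^sup>2 / 2
        \<le> c / \<beta> - v \<bullet> (z - q) + 1/2 * (norm (z - x))\<^sup>2"
      using inner_ge_zero[of "z - x - v"] unfolding power2_norm_eq_inner
      by (simp add: algebra_simps inner_commute)
    ultimately show ?thesis by (rule ereal_le_add_real)
  qed
  then obtain p where p: "p \<in> Argmin (\<lambda>z. h z + ereal (1/2 * (norm (z - x))\<^sup>2))"
    by (rule prox_objective_minimizer_exists[OF h])
  then have T: "prox_grad \<beta> f g y = p"
    using prox_eqI[OF h(1,3) p] unfolding prox_grad_def h_def x_def by simp
  obtain s where s: "h p = ereal s" "\<And>z. ereal (s + (x - p) \<bullet> (z - p)) \<le> h z"
    using prox_objective_subgradient[OF h(1,3) p] by blast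
  have hg: "g z = ereal \<beta> * h z" for z
    unfolding h_def using \<open>0 < \<beta>\<close> by (simp add: mult.assoc[symmetric] one_ereal_def[symmetric])
  show thesis
  proof (rule that)
    show "g (prox_grad \<beta> f g y) = ereal (\<beta> * s)" unfolding T hg s(1) by simp
    have "ereal \<beta> * ereal (s + (x - p) \<bullet> (z - p)) \<le> g z" for z
      unfolding hg[of z] using s(2)[of z] \<open>0 < \<beta>\<close> by (intro ereal_mult_left_mono) auto
    then show "ereal (\<beta> * s + \<beta> * ((y - (1/\<beta>) *\<^sub>R gradient f y - prox_grad \<beta> f g y)
        \<bullet> (z - prox_grad \<beta> f g y))) \<le> g z" for z
      unfolding T x_def by (simp add: distrib_left)
  qed
qed

text \<open>Add three estimates: the subgradient inequality for \<open>g\<close> at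
  \<open>p\<close>, the descent lemma for \<open>f\<close> from \<open>y\<close> to
  \<open>p\<close>, and the tangent inequality for \<open>f\<close> from \<open>y\<close> to
  \<open>z\<close>. The gradient terms cancel.\<close>

lemma prox_grad_inequality:
  fixes f :: "'a::{real_inner,complete_space} \<Rightarrow> real"
  assumes "0 < \<beta>" and cvx: "convex_on UNIV f" and sm: "smooth_with \<beta> f"
    and g: "convex_ereal g" "lower_semicontinuous g" "proper_fun g"
    and argmin: "Argmin (\<lambda>z. ereal (f z) + g z) \<noteq> {}"
  obtains r where "ereal (f (prox_grad \<beta> f g y)) + g (prox_grad \<beta> f g y) = ereal r"
    and "\<And>z. ereal (r + \<beta>/2 * (norm (z - prox_grad \<beta> f g y))\<^sup>2)
      \<le> ereal (f z) + g z + ereal (\<beta>/2 * (norm (z - y))\<^sup>2)"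
proof -
  define p where "p = prox_grad \<beta> f g y"
  obtain r where r: "g p = ereal r"
    "\<And>z. ereal (r + \<beta> * ((y - (1/\<beta>) *\<^sub>R gradient f y - p) \<bullet> (z - p))) \<le> g z"
    using prox_grad_minimizer_subgradient[OF assms, of y] unfolding p_def by blast
  have "ereal (f p + r + \<beta>/2 * (norm (z - p))\<^sup>2) \<le> ereal (f z) + g z + ereal (\<beta>/2 * (norm (z - y))\<^sup>2)" for z
  proof (cases "g z")
    case (real c)
    have "r + \<beta> * ((y - (1/\<beta>) *\<^sub>R gradient f y - p) \<bullet> (z - p)) \<le> c"
      using r(2)[of z] real by simp
    moreover have "\<beta> * ((y - (1/\<beta>) *\<^sub>R gradient f y - p) \<bullet> (z - p))
        = \<beta> * ((y - p) \<bullet> (z - p)) - gradient f y \<bullet> (z - p)"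
      using \<open>0 < \<beta>\<close> by (simp add: inner_diff_left algebra_simps)
    moreover have "f p \<le> f y + gradient f y \<bullet> (p - y) + \<beta> / 2 * (norm (p - y))\<^sup>2"
      using smooth_with_upper_bound[OF sm sm] .
    moreover have "f y + gradient f y \<bullet> (z - y) \<le> f z"
      using convex_gradient_inequality[OF cvx sm] .
    moreover have "gradient f y \<bullet> (z - p) = gradient f y \<bullet> (z - y) - gradient f y \<bullet> (p - y)"
      by (simp add: inner_diff_right)
    \<comment> \<open>The law of cosines for the triangle \<open>y\<close>, \<open>p\<close>,
      \<open>z\<close> absorbs the remaining inner product.\<close>
    moreover have "\<beta>/2 * (norm (z - p))\<^sup>2 + \<beta>/2 * (norm (p - y))\<^sup>2
        = \<beta>/2 * (norm (z - y))\<^sup>2 + \<beta> * ((y - p) \<bullet> (z - p))"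
      unfolding power2_norm_eq_inner by (simp add: algebra_simps inner_commute)
    ultimately show ?thesis using real by simp
  qed (use g(3) in \<open>auto simp: proper_fun_def\<close>)
  moreover have "ereal (f p) + g p = ereal (f p + r)" using r(1) by simp
  ultimately show thesis using that unfolding p_def by blast
qed

section \<open>FISTA recursions of linear operators\<close>

text \<open>Projection is the prox of the indicator function of \<open>C\<close>, and its
  subgradient inequality on \<open>C\<close> is the variational inequality.\<close>

lemma closed_convex_projection:
  fixes C :: "'a::{real_inner,complete_space} set"
  assumes "closed C" "convex C" "C \<noteq> {}"
  obtains p where "p \<in> C" "\<And>c. c \<in> C \<Longrightarrow> (x - p) \<bullet> (c - p) \<le> 0"
proof -
  define h :: "'a \<Rightarrow> ereal" where "h = (\<lambda>z. if z \<in> C then 0 else \<infinity>)"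
  have "convex_ereal h"
    unfolding convex_ereal_def h_def using \<open>convex C\<close> by (auto simp: convex_def)
  moreover have "lower_semicontinuous h"
    unfolding lower_semicontinuous_def
  proof
    fix z show "h z \<le> Liminf (nhds z) h"
    proof (cases "z \<in> C")
      case True
      then show ?thesis unfolding h_def by (auto intro!: Liminf_bounded always_eventually)
    next
      case False
      then have "eventually (\<lambda>w. w \<in> - C) (nhds z)"
        using \<open>closed C\<close> by (intro eventually_nhds_in_open) auto
      then have "eventually (\<lambda>w. h z \<le> h w) (nhds z)"
        by (rule eventually_mono) (simp add: h_def)
      then show ?thesis by (rule Liminf_bounded)
    qed
  qed
  moreover have prp: "proper_fun h"
    unfolding proper_fun_def h_def using \<open>C \<noteq> {}\<close> by auto
  moreover have "ereal 0 \<le> h z + ereal (1/2 * (norm (z - x))\<^sup>2)" for z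
    unfolding h_def by simp
  ultimately obtain p where p: "p \<in> Argmin (\<lambda>z. h z + ereal (1/2 * (norm (z - x))\<^sup>2))"
    by (rule prox_objective_minimizer_exists)
  obtain r where r: "h p = ereal r" "\<And>z. ereal (r + (x - p) \<bullet> (z - p)) \<le> h z"
    using prox_objective_subgradient[OF \<open>convex_ereal h\<close> prp p] by blast
  have "p \<in> C" using r(1) unfolding h_def by (auto split: if_splits)
  moreover have "(x - p) \<bullet> (c - p) \<le> 0" if "c \<in> C" for c
    using r(1) r(2)[of c] \<open>p \<in> C\<close> that unfolding h_def by (simp add: zero_ereal_def)
  ultimately show thesis by (rule that)
qed

section \<open>Growth of the FISTA parameters\<close>

lemma fista_parameters_ge_1:
  assumes "fista_parameters t"
  shows "1 \<le> t n"
proof -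
  have "t n \<ge> (real n + 2) / 2" using assms unfolding fista_parameters_def by blast
  then show ?thesis by simp
qed

text \<open>The recursion lets \<open>t\<close> grow by at most 1 per step. Together with the linear
  lower bound this keeps the inertial coefficients bounded.\<close>

lemma fista_parameters_le:
  assumes "fista_parameters t"
  shows "t n \<le> real n + 1"
proof (induction n)
  case 0
  then show ?case using assms unfolding fista_parameters_def by simp
next
  case (Suc n)
  have ge: "1 \<le> t n" "1 \<le> t (Suc n)" using fista_parameters_ge_1[OF assms] by auto
  have "(t (Suc n))\<^sup>2 - t (Suc n) \<le> (t n)\<^sup>2" using assms unfolding fista_parameters_def by blast
  have "t (Suc n) \<le> t n + 1"
  proof (rule ccontr)
    assume "\<not> t (Suc n) \<le> t n + 1"
    then have "t n * t n < t (Suc n) * (t (Suc n) - 1)"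
      using ge by (intro mult_strict_mono) auto
    then show False using \<open>_ \<le> (t n)\<^sup>2\<close> by (simp add: power2_eq_square algebra_simps)
  qed
  then show ?case using Suc.IH by simp
qed

lemma fista_parameters_ratio:
  assumes "fista_parameters t"
  shows "\<bar>(t n - 1) / t (Suc n)\<bar> \<le> 2"
proof -
  have "(real (Suc n) + 2) / 2 \<le> t (Suc n)" using assms unfolding fista_parameters_def by blast
  then have "t n - 1 \<le> 2 * t (Suc n)" using fista_parameters_le[OF assms, of n] by simp
  then show ?thesis
    using fista_parameters_ge_1[OF assms, of n] fista_parameters_ge_1[OF assms, of "Suc n"]
    by (simp add: field_simps)
qed

section \<open>Existence, symmetries and limits of FISTA sequences\<close>

lemma fista_sequences_exist: "\<exists>x y. fista_sequences T t x0 x y"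
proof -
  define s where "s = rec_nat (x0, x0) (\<lambda>n (a, b). (T b, T b + ((t n - 1) / t (Suc n)) *\<^sub>R (T b - a)))"
  have "fista_sequences T t x0 (\<lambda>n. fst (s n)) (\<lambda>n. snd (s n))"
    unfolding fista_sequences_def s_def by (auto simp: case_prod_beta)
  then show ?thesis by blast
qed

text \<open>This replaces the description of the iterates as polynomials in \<open>L\<close>: a
  linear map commuting with \<open>L\<close> sends runs to runs. It is applied with
  \<open>Id - L\<close>.\<close>

lemma fista_sequences_linear_image:
  assumes "fista_sequences L t u x y" "linear A" "\<And>w. A (L w) = L (A w)"
  shows "fista_sequences L t (A u) (\<lambda>n. A (x n)) (\<lambda>n. A (y n))"
  using assms unfolding fista_sequences_def by (auto simp: linear_add linear_diff linear_scale)

lemma fista_sequences_diff: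
  assumes "linear L" "fista_sequences L t u x y" "fista_sequences L t v x' y'"
  shows "fista_sequences L t (u - v) (\<lambda>n. x n - x' n) (\<lambda>n. y n - y' n)"
  using assms(2,3) unfolding fista_sequences_def
  by (auto simp: linear_diff[OF assms(1)] scaleR_diff_right)

text \<open>Moving the origin to \<open>p\<close> removes the constant part of \<open>T\<close>; the
  inertial term only sees differences and is unaffected.\<close>

lemma fista_sequences_translate:
  assumes "fista_sequences T t x0 x y" "\<And>w. T (p + w) = p + L w"
  shows "fista_sequences L t (x0 - p) (\<lambda>n. x n - p) (\<lambda>n. y n - p)"
proof -
  have "L (w - p) = T w - p" for w using assms(2)[of "w - p"] by simp
  then show ?thesis using assms(1) unfolding fista_sequences_def by (simp add: algebra_simps)
qed

lemma fista_sequences_translate':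
  assumes "fista_sequences L t u x y" "\<And>w. T (p + w) = p + L w"
  shows "fista_sequences T t (p + u) (\<lambda>n. p + x n) (\<lambda>n. p + y n)"
  using assms unfolding fista_sequences_def by auto

text \<open>The inertial term is a bounded coefficient times a difference of consecutive iterates,
  which tends to 0.\<close>

lemma fista_sequences_y_tendsto:
  fixes x :: "nat \<Rightarrow> 'a::real_normed_vector"
  assumes t: "fista_parameters t" and seq: "fista_sequences T t x0 x y" and x: "x \<longlonglongrightarrow> l"
  shows "y \<longlonglongrightarrow> l"
proof -
  have "(\<lambda>n. x (Suc n) - x n) \<longlonglongrightarrow> l - l" by (intro tendsto_diff LIMSEQ_Suc x)
  then have "(\<lambda>n. 2 * norm (x (Suc n) - x n)) \<longlonglongrightarrow> 0"
    by (auto intro: tendsto_mult_right_zero tendsto_norm_zero)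
  moreover have "\<forall>n. norm (((t n - 1) / t (Suc n)) *\<^sub>R (x (Suc n) - x n)) \<le> 2 * norm (x (Suc n) - x n)"
    unfolding norm_scaleR using fista_parameters_ratio[OF t] by (intro allI mult_right_mono) auto
  ultimately have "(\<lambda>n. ((t n - 1) / t (Suc n)) *\<^sub>R (x (Suc n) - x n)) \<longlonglongrightarrow> 0"
    by (rule Lim_null_comparison[OF always_eventually, rotated])
  then have "(\<lambda>n. x (Suc n) + ((t n - 1) / t (Suc n)) *\<^sub>R (x (Suc n) - x n)) \<longlonglongrightarrow> l + 0"
    by (intro tendsto_add LIMSEQ_Suc x)
  then have "(\<lambda>n. y (Suc n)) \<longlonglongrightarrow> l" using seq unfolding fista_sequences_def by simp
  then show ?thesis by (rule LIMSEQ_imp_Suc)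
qed

lemma fista_linear_tendsto_0:
  fixes L :: "'a::real_normed_vector \<Rightarrow> 'a"
  assumes L: "linear L"
    and bound: "\<And>u x y n. fista_sequences L t u x y \<Longrightarrow> norm (x n) \<le> norm u"
    and asym: "\<And>u x y. fista_sequences L t u x y \<Longrightarrow> (\<lambda>n. x n - L (x n)) \<longlonglongrightarrow> 0"
    and u: "u \<in> closure (range (\<lambda>w. w - L w))"
    and seq: "fista_sequences L t u x y"
  shows "x \<longlonglongrightarrow> 0"
proof (rule LIMSEQ_I)
  fix e :: real assume "0 < e"
  then obtain z where z: "dist (z - L z) u < e / 2"
    using u unfolding closure_approachable by (metis half_gt_zero rangeE)
  obtain x' y' where seq': "fista_sequences L t z x' y'" using fista_sequences_exist by blast
  have "linear (\<lambda>w. w - L w)"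
    by (intro linearI) (auto simp: linear_add[OF L] linear_scale[OF L] scaleR_diff_right)
  then have "fista_sequences L t (z - L z) (\<lambda>n. x' n - L (x' n)) (\<lambda>n. y' n - L (y' n))"
    by (rule fista_sequences_linear_image[OF seq']) (simp add: linear_diff[OF L])
  \<comment> \<open>The difference of the two runs is itself a run, started at
    \<open>u - (z - L z)\<close>, so the closeness of the starting points persists for all
    \<open>n\<close>.\<close>
  then have "norm (x n - (x' n - L (x' n))) \<le> norm (u - (z - L z))" for n
    using bound[OF fista_sequences_diff[OF L seq]] by blast
  then have diff: "norm (x n - (x' n - L (x' n))) < e / 2" for n
    using z unfolding dist_norm by (metis norm_minus_commute order_le_less_trans)
  obtain N where N: "\<And>n. n \<ge> N \<Longrightarrow> norm (x' n - L (x' n)) < e / 2"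
    using LIMSEQ_D[OF asym[OF seq'], of "e / 2"] \<open>0 < e\<close> by auto
  have "norm (x n - 0) < e" if "n \<ge> N" for n
    using N[OF that] diff[of n] norm_triangle_sub[of "x n" "x' n - L (x' n)"] by simp
  then show "\<exists>N. \<forall>n\<ge>N. norm (x n - 0) < e" by blast
qed

section \<open>Fixed points and range of \<open>Id - L\<close> for a linear nonexpansive
  \<open>L\<close>\<close>

context
  fixes L :: "'a::real_inner \<Rightarrow> 'a"
  assumes linear_L: "linear L" and norm_L: "\<And>u. norm (L u) \<le> norm u"
begin

text \<open>Expand \<open>norm (L (v + s *\<^sub>R w)) \<le> norm (v + s *\<^sub>R w)\<close> using
  \<open>L v = v\<close>: the constant terms cancel, and the terms linear in \<open>s\<close> must
  vanish because \<open>s\<close> may have either sign.\<close>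

lemma linear_nonexpansive_fixed_orthogonal:
  assumes "L v = v"
  shows "v \<bullet> (w - L w) = 0"
proof -
  let ?c = "((norm w)\<^sup>2 - (norm (L w))\<^sup>2) / 2"
  have *: "s * - (v \<bullet> (w - L w)) \<le> s * 0 + s\<^sup>2 * ?c" for s
  proof -
    have "(norm (L (v + s *\<^sub>R w)))\<^sup>2 \<le> (norm (v + s *\<^sub>R w))\<^sup>2"
      using norm_L by (simp add: power_mono)
    then show ?thesis
      unfolding linear_add[OF linear_L] linear_scale[OF linear_L] assms power2_norm_eq_inner
      by (simp add: power2_eq_square algebra_simps inner_commute)
  qed
  have "- (v \<bullet> (w - L w)) \<le> 0" by (rule ge_of_perturbation[OF *])
  moreover have "v \<bullet> (w - L w) \<le> 0"
    by (rule ge_of_perturbation[of _ _ ?c]) (use *[of "- _"] in simp)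
  ultimately show ?thesis by simp
qed

lemma linear_nonexpansive_orthogonal_fixed:
  assumes "v \<bullet> (v - L v) = 0"
  shows "L v = v"
proof -
  have "(norm (v - L v))\<^sup>2 = 2 * (v \<bullet> (v - L v)) + (norm (L v))\<^sup>2 - (norm v)\<^sup>2"
    unfolding power2_norm_eq_inner by (simp add: algebra_simps inner_commute)
  also have "\<dots> \<le> 0" using assms norm_L[of v] by (simp add: power_mono)
  finally show ?thesis by simp
qed

lemma fixed_orthogonal_closure_range:
  assumes "L v = v" "a \<in> closure (range (\<lambda>w. w - L w))"
  shows "a \<bullet> v = 0"
proof -
  have "closure (range (\<lambda>w. w - L w)) \<subseteq> {a. v \<bullet> a = 0}"
    by (rule closure_minimal)
      (use linear_nonexpansive_fixed_orthogonal[OF assms(1)] in \<open>auto simp: closed_hyperplane\<close>)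
  then show ?thesis using assms(2) by (auto simp: inner_commute)
qed

end

lemma subspace_closure:
  fixes S :: "'a::real_normed_vector set"
  assumes "subspace S"
  shows "subspace (closure S)"
proof (rule subspaceI)
  show "0 \<in> closure S" using subspace_0[OF assms] closure_subset by (rule rev_subsetD)
next
  fix a b assume "a \<in> closure S" "b \<in> closure S"
  then obtain u v where u: "\<forall>n. u n \<in> S" "u \<longlonglongrightarrow> a" and v: "\<forall>n. v n \<in> S" "v \<longlonglongrightarrow> b"
    unfolding closure_sequential by blast
  then have "\<forall>n. u n + v n \<in> S" using subspace_add[OF assms] by blast
  then show "a + b \<in> closure S"
    unfolding closure_sequential using tendsto_add[OF u(2) v(2)] by (intro exI conjI)
next
  fix c a assume "a \<in> closure S"
  then obtain u where u: "\<forall>n. u n \<in> S" "u \<longlonglongrightarrow> a" unfolding closure_sequential by blast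
  then have "\<forall>n. c *\<^sub>R u n \<in> S" using subspace_scale[OF assms] by blast
  then show "c *\<^sub>R a \<in> closure S"
    unfolding closure_sequential using tendsto_scaleR[OF tendsto_const u(2)] by (intro exI conjI)
qed

text \<open>Project \<open>u\<close> onto the closed range of \<open>Id - L\<close>. The residual is
  orthogonal to that subspace, in particular to its own image under \<open>Id - L\<close>, and
  nonexpansiveness then makes it fixed.\<close>

lemma linear_nonexpansive_decomposition:
  fixes L :: "'a::{real_inner,complete_space} \<Rightarrow> 'a"
  assumes L: "linear L" and norm_L: "\<And>u. norm (L u) \<le> norm u"
  obtains a where "a \<in> closure (range (\<lambda>w. w - L w))" "L (u - a) = u - a"
proof -
  let ?R = "closure (range (\<lambda>w. w - L w))"
  have lin: "linear (\<lambda>w. w - L w)"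
    by (intro linearI) (auto simp: linear_add[OF L] linear_scale[OF L] scaleR_diff_right)
  then have sub: "subspace ?R"
    by (intro subspace_closure) (rule linear_subspace_image, simp_all)
  then have "convex ?R" "?R \<noteq> {}" using subspace_imp_convex subspace_0 by auto
  then obtain a where a: "a \<in> ?R" "\<And>c. c \<in> ?R \<Longrightarrow> (u - a) \<bullet> (c - a) \<le> 0"
    using closed_convex_projection[of ?R u] by blast
  \<comment> \<open>On a subspace the variational inequality can be tested at \<open>a + c\<close>
    and at \<open>a - c\<close>, which gives orthogonality.\<close>
  have le: "(u - a) \<bullet> c \<le> 0" if "c \<in> ?R" for c
    using a(2)[of "a + c"] subspace_add[OF sub a(1) that] by simp
  have "(u - a) \<bullet> c = 0" if "c \<in> ?R" for c
    using le[OF that] le[OF subspace_neg[OF sub that]] by simp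
  moreover have "(u - a) - L (u - a) \<in> ?R" by (rule subsetD[OF closure_subset]) (rule rangeI)
  ultimately have "(u - a) \<bullet> ((u - a) - L (u - a)) = 0" by blast
  then have "L (u - a) = u - a" by (rule linear_nonexpansive_orthogonal_fixed[OF L norm_L])
  with a(1) show thesis by (rule that)
qed

text \<open>The variational inequality yields a Pythagorean inequality; its extra term
  \<open>(dist p c)\<^sup>2\<close> forces uniqueness.\<close>

lemma metric_proj_eqI:
  fixes p :: "'a::real_inner"
  assumes "p \<in> C" "\<And>c. c \<in> C \<Longrightarrow> (x - p) \<bullet> (c - p) \<le> 0"
  shows "metric_proj C x = p"
proof -
  have *: "(dist x p)\<^sup>2 + (dist p c)\<^sup>2 \<le> (dist x c)\<^sup>2" if "c \<in> C" for c
  proof -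
    have "(norm (x - c))\<^sup>2 = (norm (x - p))\<^sup>2 + (norm (p - c))\<^sup>2 - 2 * ((x - p) \<bullet> (c - p))"
      unfolding power2_norm_eq_inner by (simp add: algebra_simps inner_commute)
    then show ?thesis using assms(2)[OF that] unfolding dist_norm by simp
  qed
  show ?thesis
    unfolding metric_proj_def
  proof (rule the_equality)
    have "dist x p \<le> dist x c" if "c \<in> C" for c
    proof -
      have "(dist x p)\<^sup>2 \<le> (dist x c)\<^sup>2"
        using *[OF that] zero_le_power2[of "dist p c"] by linarith
      then show ?thesis by (rule power2_le_imp_le) simp
    qed
    then show "p \<in> C \<and> (\<forall>c\<in>C. dist x p \<le> dist x c)" using assms(1) by blast
  next
    fix q assume q: "q \<in> C \<and> (\<forall>c\<in>C. dist x q \<le> dist x c)"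
    then have "(dist x q)\<^sup>2 \<le> (dist x p)\<^sup>2" using assms(1) by (simp add: power_mono)
    then have "(dist p q)\<^sup>2 \<le> 0" using *[of q] q by linarith
    then show "q = p" by simp
  qed
qed

section \<open>The energy argument\<close>

text \<open>Isolates the one-step inequality as the interface to the energy argument, in which
  \<open>f\<close> and \<open>g\<close> appear only through their sum \<open>F\<close>.\<close>

locale prox_grad_descent =
  fixes F :: "'a::real_inner \<Rightarrow> ereal" and T :: "'a \<Rightarrow> 'a" and \<beta> :: real
  assumes \<beta>_pos: "0 < \<beta>" and F_convex: "convex_ereal F"
    and F_T_finite: "\<bar>F (T y)\<bar> \<noteq> \<infinity>"
    and F_T_descent: "F (T y) + ereal (\<beta>/2 * (norm (z - T y))\<^sup>2) \<le> F z + ereal (\<beta>/2 * (norm (z - y))\<^sup>2)"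
begin

text \<open>Infinite values become 0, so \<open>\<phi>\<close> is meaningful only where
  \<open>F\<close> is finite: on the range of \<open>T\<close> and on minimizers. The starting point
  may lie outside.\<close>

definition \<phi> :: "'a \<Rightarrow> real" where "\<phi> z = real_of_ereal (F z)"

lemma F_T: "F (T y) = ereal (\<phi> (T y))"
  unfolding \<phi>_def using F_T_finite by (simp add: ereal_real)

lemma descent:
  assumes "F z \<le> ereal c"
  shows "\<phi> (T y) + \<beta>/2 * (norm (z - T y))\<^sup>2 \<le> c + \<beta>/2 * (norm (z - y))\<^sup>2"
proof -
  have "F (T y) + ereal (\<beta>/2 * (norm (z - T y))\<^sup>2) \<le> ereal c + ereal (\<beta>/2 * (norm (z - y))\<^sup>2)"
    using F_T_descent assms by (meson add_right_mono order_trans)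
  then show ?thesis unfolding F_T by simp
qed

text \<open>At a minimizer, the one-step inequality with \<open>z = y = p\<close> bounds
  \<open>norm (p - T p)\<close> by a nonpositive decrease of \<open>F\<close>. At a fixed point the
  two quadratic terms coincide and cancel.\<close>

lemma Argmin_eq_fixed: "Argmin F = {p. T p = p}"
proof (intro equalityI subsetI CollectI)
  fix p assume p: "p \<in> Argmin F"
  then have "F p \<le> ereal (\<phi> (T p))" unfolding Argmin_def F_T[symmetric] by blast
  moreover from this obtain c where c: "F p = ereal c"
    using F_T_descent[of p p] unfolding F_T by (cases "F p") auto
  ultimately have "c \<le> \<phi> (T p)" by simp
  moreover have "\<phi> (T p) + \<beta>/2 * (norm (p - T p))\<^sup>2 \<le> c + \<beta>/2 * (norm (p - p))\<^sup>2"
    using c by (intro descent) simp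
  ultimately have "\<beta> * (norm (p - T p))\<^sup>2 \<le> 0" by simp
  then show "T p = p" using \<beta>_pos by (simp add: mult_le_0_iff)
next
  fix p assume "p \<in> {p. T p = p}"
  then have fixp: "T p = p" by simp
  have "F p \<le> F z" for z
  proof -
    have "F p + ereal (\<beta>/2 * (norm (z - p))\<^sup>2) \<le> F z + ereal (\<beta>/2 * (norm (z - p))\<^sup>2)"
      using F_T_descent[of p z] unfolding fixp .
    then show ?thesis by (cases "F p"; cases "F z") auto
  qed
  then show "p \<in> Argmin F" unfolding Argmin_def by blast
qed

lemma Argmin_\<phi>:
  assumes "p \<in> Argmin F"
  shows "F p = ereal (\<phi> p)" "\<phi> p \<le> \<phi> (T y)"
proof -
  have "T p = p" using assms unfolding Argmin_eq_fixed by simp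
  then show "F p = ereal (\<phi> p)" using F_T[of p] by simp
  then show "\<phi> p \<le> \<phi> (T y)"
    using assms F_T[of y] unfolding Argmin_def by (metis (mono_tags) ereal_less_eq(3) mem_Collect_eq)
qed

text \<open>Test the one-step inequality at the convex combination of \<open>a\<close> and
  \<open>p\<close> with weight \<open>1/s\<close> on \<open>p\<close>, then multiply by
  \<open>s\<^sup>2\<close>. The case \<open>s = 1\<close> gives \<open>a\<close> weight 0, which
  covers the first step, where \<open>F x0\<close> may be infinite.\<close>

lemma energy_step:
  assumes p: "p \<in> Argmin F" and "1 \<le> s" and a: "s = 1 \<or> F a = ereal (\<phi> a)"
  shows "s\<^sup>2 * (\<phi> (T b) - \<phi> p) + \<beta>/2 * (norm (s *\<^sub>R T b - (s - 1) *\<^sub>R a - p))\<^sup>2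
    \<le> (s\<^sup>2 - s) * (\<phi> a - \<phi> p) + \<beta>/2 * (norm (s *\<^sub>R b - (s - 1) *\<^sub>R a - p))\<^sup>2"
proof -
  define z where "z = (1 - 1/s) *\<^sub>R a + (1/s) *\<^sub>R p"
  have scale: "s\<^sup>2 * (norm (z - w))\<^sup>2 = (norm (s *\<^sub>R w - (s - 1) *\<^sub>R a - p))\<^sup>2" for w
  proof -
    have "s *\<^sub>R (z - w) = - (s *\<^sub>R w - (s - 1) *\<^sub>R a - p)"
      unfolding z_def using \<open>1 \<le> s\<close> by (simp add: algebra_simps)
    then show ?thesis by (metis norm_minus_cancel norm_scaleR power2_abs power_mult_distrib)
  qed
  have "F z \<le> ereal ((1 - 1/s) * \<phi> a + (1/s) * \<phi> p)"
  proof (cases "s = 1")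
    case True
    then show ?thesis unfolding z_def using Argmin_\<phi>(1)[OF p] by simp
  next
    case False
    then show ?thesis unfolding z_def
      using \<open>1 \<le> s\<close> a Argmin_\<phi>(1)[OF p] by (intro convex_erealD[OF F_convex]) auto
  qed
  then have "\<phi> (T b) + \<beta>/2 * (norm (z - T b))\<^sup>2
      \<le> (1 - 1/s) * \<phi> a + (1/s) * \<phi> p + \<beta>/2 * (norm (z - b))\<^sup>2"
    by (rule descent)
  then have "s\<^sup>2 * (\<phi> (T b) + \<beta>/2 * (norm (z - T b))\<^sup>2)
      \<le> s\<^sup>2 * ((1 - 1/s) * \<phi> a + (1/s) * \<phi> p + \<beta>/2 * (norm (z - b))\<^sup>2)"
    by (rule mult_left_mono) simp
  also have "\<dots> = (s\<^sup>2 - s) * \<phi> a + s * \<phi> p + \<beta>/2 * (s\<^sup>2 * (norm (z - b))\<^sup>2)"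
    using \<open>1 \<le> s\<close> by (simp add: field_simps power2_eq_square)
  finally have "s\<^sup>2 * \<phi> (T b) + \<beta>/2 * (s\<^sup>2 * (norm (z - T b))\<^sup>2)
      \<le> (s\<^sup>2 - s) * \<phi> a + s * \<phi> p + \<beta>/2 * (s\<^sup>2 * (norm (z - b))\<^sup>2)"
    by (simp add: algebra_simps)
  then show ?thesis unfolding scale by (simp add: algebra_simps)
qed

section \<open>Energy estimates along a FISTA run\<close>

context
  fixes t :: "nat \<Rightarrow> real" and x0 :: 'a and x y :: "nat \<Rightarrow> 'a" and p :: 'a
  assumes t: "fista_parameters t" and seq: "fista_sequences T t x0 x y" and p: "p \<in> Argmin F"
begin

lemma seq_simps: "x 0 = x0" "y 0 = x0" "x (Suc n) = T (y n)"
  "y (Suc n) = x (Suc n) + ((t n - 1) / t (Suc n)) *\<^sub>R (x (Suc n) - x n)"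
  using seq unfolding fista_sequences_def by auto

lemma fista_energy:
  "(t n)\<^sup>2 * (\<phi> (x (Suc n)) - \<phi> p)
    + \<beta>/2 * (norm (t n *\<^sub>R x (Suc n) - (t n - 1) *\<^sub>R x n - p))\<^sup>2 \<le> \<beta>/2 * (norm (x0 - p))\<^sup>2"
proof (induction n)
  case 0
  have "t 0 = 1" using t unfolding fista_parameters_def by simp
  then show ?case using energy_step[OF p, of 1 x0 x0] by (simp add: seq_simps)
next
  case (Suc n)
  let ?s = "t (Suc n)"
  have s: "1 \<le> ?s" by (rule fista_parameters_ge_1[OF t])
  \<comment> \<open>The extrapolation coefficient is chosen for this identity: the vector entering
    the new step is the one left by the previous step, so the energies chain.\<close>
  have y: "?s *\<^sub>R y (Suc n) - (?s - 1) *\<^sub>R x (Suc n) = t n *\<^sub>R x (Suc n) - (t n - 1) *\<^sub>R x n"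
  proof -
    have "?s *\<^sub>R y (Suc n) = ?s *\<^sub>R x (Suc n) + (t n - 1) *\<^sub>R (x (Suc n) - x n)"
      using s unfolding seq_simps(4) by (simp add: scaleR_add_right)
    then show ?thesis by (simp add: algebra_simps)
  qed
  have "F (x (Suc n)) = ereal (\<phi> (x (Suc n)))" unfolding seq_simps(3) by (rule F_T)
  then have "?s\<^sup>2 * (\<phi> (x (Suc (Suc n))) - \<phi> p)
      + \<beta>/2 * (norm (?s *\<^sub>R x (Suc (Suc n)) - (?s - 1) *\<^sub>R x (Suc n) - p))\<^sup>2
    \<le> (?s\<^sup>2 - ?s) * (\<phi> (x (Suc n)) - \<phi> p)
      + \<beta>/2 * (norm (t n *\<^sub>R x (Suc n) - (t n - 1) *\<^sub>R x n - p))\<^sup>2"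
    using energy_step[OF p s, of "x (Suc n)" "y (Suc n)"] unfolding y seq_simps(3)[of "Suc n"] by blast
  moreover have "(?s\<^sup>2 - ?s) * (\<phi> (x (Suc n)) - \<phi> p) \<le> (t n)\<^sup>2 * (\<phi> (x (Suc n)) - \<phi> p)"
    using t Argmin_\<phi>(2)[OF p, of "y n"] unfolding fista_parameters_def seq_simps(3)
    by (intro mult_right_mono) auto
  ultimately show ?case using Suc.IH by linarith
qed

text \<open>The energy bounds \<open>norm ?z\<close> by \<open>norm (x0 - p)\<close>, and
  \<open>x (Suc n) - p\<close> is the convex combination of \<open>x n - p\<close> and
  \<open>?z\<close> with weight \<open>1 / t n\<close> on \<open>?z\<close>; so the ball around
  \<open>p\<close> is never left.\<close>

lemma fista_norm_le: "norm (x n - p) \<le> norm (x0 - p)"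
proof (induction n)
  case 0
  then show ?case by (simp add: seq_simps)
next
  case (Suc n)
  let ?s = "t n" and ?z = "t n *\<^sub>R x (Suc n) - (t n - 1) *\<^sub>R x n - p"
  have s: "1 \<le> ?s" by (rule fista_parameters_ge_1[OF t])
  have "0 \<le> ?s\<^sup>2 * (\<phi> (x (Suc n)) - \<phi> p)"
    using Argmin_\<phi>(2)[OF p, of "y n"] unfolding seq_simps(3) by simp
  then have "\<beta>/2 * (norm ?z)\<^sup>2 \<le> \<beta>/2 * (norm (x0 - p))\<^sup>2" using fista_energy[of n] by linarith
  then have "(norm ?z)\<^sup>2 \<le> (norm (x0 - p))\<^sup>2" using \<beta>_pos by simp
  then have z: "norm ?z \<le> norm (x0 - p)" by (rule power2_le_imp_le) simp
  have "?s *\<^sub>R (x (Suc n) - p) = (?s - 1) *\<^sub>R (x n - p) + ?z" by (simp add: algebra_simps)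
  then have "?s * norm (x (Suc n) - p) \<le> norm ((?s - 1) *\<^sub>R (x n - p)) + norm ?z"
    using s norm_triangle_ineq[of "(?s - 1) *\<^sub>R (x n - p)" ?z] norm_scaleR[of ?s "x (Suc n) - p"] by simp
  also have "\<dots> \<le> (?s - 1) * norm (x0 - p) + norm (x0 - p)"
    using s z Suc.IH by (intro add_mono) (auto intro: mult_left_mono)
  also have "\<dots> = ?s * norm (x0 - p)" by (simp add: algebra_simps)
  finally show ?case using s by simp
qed

lemma fista_values_le: "\<phi> (x (Suc n)) - \<phi> p \<le> \<beta>/2 * (4 * (norm (x0 - p))\<^sup>2 / (real n + 2)\<^sup>2)"
proof -
  have "0 \<le> \<beta>/2 * (norm (t n *\<^sub>R x (Suc n) - (t n - 1) *\<^sub>R x n - p))\<^sup>2" using \<beta>_pos by simp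
  then have "(t n)\<^sup>2 * (\<phi> (x (Suc n)) - \<phi> p) \<le> \<beta>/2 * (norm (x0 - p))\<^sup>2"
    using fista_energy[of n] by linarith
  moreover have "((real n + 2) / 2)\<^sup>2 * (\<phi> (x (Suc n)) - \<phi> p) \<le> (t n)\<^sup>2 * (\<phi> (x (Suc n)) - \<phi> p)"
    using t Argmin_\<phi>(2)[OF p, of "y n"] unfolding fista_parameters_def seq_simps(3)
    by (intro mult_right_mono power_mono) auto
  moreover have "((real n + 2) / 2)\<^sup>2 * (\<phi> (x (Suc n)) - \<phi> p)
      = (\<phi> (x (Suc n)) - \<phi> p) * (real n + 2)\<^sup>2 / 4"
    by (simp add: power_divide)
  ultimately have "(\<phi> (x (Suc n)) - \<phi> p) * (real n + 2)\<^sup>2 \<le> \<beta>/2 * (4 * (norm (x0 - p))\<^sup>2)"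
    by linarith
  then show ?thesis by (simp add: pos_le_divide_eq)
qed

text \<open>The one-step inequality with test point and base point both \<open>x (Suc n)\<close>
  bounds the squared residual by the value gap, which tends to 0.\<close>

lemma fista_asymptotically_regular: "(\<lambda>n. x n - T (x n)) \<longlonglongrightarrow> 0"
\<comment> \<open>Index 0 is skipped because \<open>F x0\<close> may be infinite.\<close>
proof (rule LIMSEQ_imp_Suc, rule tendsto_norm_zero_cancel)
  have le: "(norm (x (Suc n) - T (x (Suc n))))\<^sup>2 \<le> 4 * (norm (x0 - p))\<^sup>2 * inverse (real (Suc n))" for n
  proof -
    let ?w = "x (Suc n)"
    have "\<phi> (T ?w) + \<beta>/2 * (norm (?w - T ?w))\<^sup>2 \<le> \<phi> ?w + \<beta>/2 * (norm (?w - ?w))\<^sup>2"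
      by (rule descent) (simp add: seq_simps(3) F_T)
    then have "\<beta>/2 * (norm (?w - T ?w))\<^sup>2 \<le> \<phi> ?w - \<phi> p"
      using Argmin_\<phi>(2)[OF p, of ?w] by simp
    also have "\<dots> \<le> \<beta>/2 * (4 * (norm (x0 - p))\<^sup>2 / (real n + 2)\<^sup>2)"
      by (rule fista_values_le)
    finally have "(norm (?w - T ?w))\<^sup>2 \<le> 4 * (norm (x0 - p))\<^sup>2 / (real n + 2)\<^sup>2"
      by (rule mult_left_le_imp_le) (use \<beta>_pos in simp)
    also have "\<dots> \<le> 4 * (norm (x0 - p))\<^sup>2 / real (Suc n)"
    proof (intro divide_left_mono mult_pos_pos zero_less_power)
      show "real (Suc n) \<le> (real n + 2)\<^sup>2" by (simp add: power2_eq_square algebra_simps)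
    qed auto
    finally show ?thesis by (simp add: field_simps)
  qed
  have "(\<lambda>n. 4 * (norm (x0 - p))\<^sup>2 * inverse (real (Suc n))) \<longlonglongrightarrow> 4 * (norm (x0 - p))\<^sup>2 * 0"
    by (intro tendsto_intros LIMSEQ_inverse_real_of_nat)
  then have lim: "(\<lambda>n. 4 * (norm (x0 - p))\<^sup>2 * inverse (real (Suc n))) \<longlonglongrightarrow> 0" by simp
  have "(\<lambda>n. (norm (x (Suc n) - T (x (Suc n))))\<^sup>2) \<longlonglongrightarrow> 0"
    by (rule tendsto_sandwich[OF _ _ tendsto_const lim]) (simp_all only: le zero_le_power2 eventually_True)
  then have "(\<lambda>n. sqrt ((norm (x (Suc n) - T (x (Suc n))))\<^sup>2)) \<longlonglongrightarrow> sqrt 0"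
    by (rule tendsto_real_sqrt)
  then show "(\<lambda>n. norm (x (Suc n) - T (x (Suc n)))) \<longlonglongrightarrow> 0" by simp
qed

end

end

section \<open>Strong convergence for an affine proximal gradient operator\<close>

lemma prox_grad_descent_prox_grad:
  fixes f :: "'a::{real_inner,complete_space} \<Rightarrow> real"
  assumes "0 < \<beta>" "convex_on UNIV f" "smooth_with \<beta> f"
    and "convex_ereal g" "lower_semicontinuous g" "proper_fun g"
    and "Argmin (\<lambda>z. ereal (f z) + g z) \<noteq> {}"
  shows "prox_grad_descent (\<lambda>z. ereal (f z) + g z) (prox_grad \<beta> f g) \<beta>"
proof
  fix y z
  obtain r where r: "ereal (f (prox_grad \<beta> f g y)) + g (prox_grad \<beta> f g y) = ereal r"
    and le: "\<And>z. ereal (r + \<beta>/2 * (norm (z - prox_grad \<beta> f g y))\<^sup>2)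
      \<le> ereal (f z) + g z + ereal (\<beta>/2 * (norm (z - y))\<^sup>2)"
    using prox_grad_inequality[OF assms] by metis
  show "\<bar>ereal (f (prox_grad \<beta> f g y)) + g (prox_grad \<beta> f g y)\<bar> \<noteq> \<infinity>" unfolding r by simp
  show "ereal (f (prox_grad \<beta> f g y)) + g (prox_grad \<beta> f g y)
      + ereal (\<beta>/2 * (norm (z - prox_grad \<beta> f g y))\<^sup>2)
    \<le> ereal (f z) + g z + ereal (\<beta>/2 * (norm (z - y))\<^sup>2)"
    unfolding r using le by simp
qed (use assms convex_ereal_add_real in auto)

theorem theorem3p2:
  fixes f :: "'a::{real_inner,complete_space} \<Rightarrow> real"
    and g :: "'a \<Rightarrow> ereal"
    and \<beta> :: real
    and S :: "'a set"
    and T :: "'a \<Rightarrow> 'a"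
    and t :: "nat \<Rightarrow> real"
    and x0 :: 'a
    and x y :: "nat \<Rightarrow> 'a"
  assumes "\<beta> > 0"
    and "convex_on UNIV f"
    and "smooth_with \<beta> f"
    and "convex_ereal g"
    and "lower_semicontinuous g"
    and "proper_fun g"
    and "S = Argmin (\<lambda>z. ereal (f z) + g z)"
    and "S \<noteq> {}"
    and "T = prox_grad \<beta> f g"
    and "fista_parameters t"
    and "fista_sequences T t x0 x y"
    and "affine_map T"
  shows "x \<longlonglongrightarrow> metric_proj S x0 \<and> y \<longlonglongrightarrow> metric_proj S x0"
proof -
  note t = assms(10) and seq = assms(11)
  interpret prox_grad_descent "\<lambda>z. ereal (f z) + g z" T \<beta>
    using prox_grad_descent_prox_grad[OF assms(1-6)] assms(7-9) by simp
  have S: "S = {p. T p = p}" using Argmin_eq_fixed assms(7) by simp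
  obtain L q where L: "linear L" and T: "T = (\<lambda>x. L x + q)"
    using assms(12) unfolding affine_map_def by blast
  obtain p0 where p0: "T p0 = p0" using assms(8) S by blast
  have shift: "T (p + w) = p + L w" if "T p = p" for p w
    using that unfolding T by (simp add: linear_add[OF L] algebra_simps)
  have mem: "p \<in> Argmin (\<lambda>z. ereal (f z) + g z)" if "T p = p" for p
    using that S assms(7) by simp
  \<comment> \<open>Every run of \<open>L\<close>, whatever its start, becomes a run of
    \<open>T\<close> after adding the minimizer \<open>p0\<close>, so the energy estimates apply to
    it.\<close>
  have bound: "norm (u n) \<le> norm a" and asym: "(\<lambda>n. u n - L (u n)) \<longlonglongrightarrow> 0"
    if uv: "fista_sequences L t a u v" for a u v and n :: nat
  proof -
    have seq': "fista_sequences T t (p0 + a) (\<lambda>n. p0 + u n) (\<lambda>n. p0 + v n)"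
      using fista_sequences_translate'[OF uv shift[OF p0]] .
    show "norm (u n) \<le> norm a"
      using fista_norm_le[OF t seq' mem[OF p0], of n] by simp
    show "(\<lambda>n. u n - L (u n)) \<longlonglongrightarrow> 0"
      using fista_asymptotically_regular[OF t seq' mem[OF p0]] by (simp add: shift[OF p0])
  qed
  \<comment> \<open>The first iterate of the run started at \<open>u\<close> is \<open>L u\<close>,
    so the uniform bound at index 1 is nonexpansiveness.\<close>
  have norm_L: "norm (L u) \<le> norm u" for u
  proof -
    obtain a b where "fista_sequences L t u a b" using fista_sequences_exist by blast
    then show ?thesis using bound[of u a b 1] unfolding fista_sequences_def by simp
  qed
  obtain a where a: "a \<in> closure (range (\<lambda>w. w - L w))" "L (x0 - p0 - a) = x0 - p0 - a"
    using linear_nonexpansive_decomposition[OF L norm_L] by blast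
  \<comment> \<open>Equivalently \<open>p = p0 + (x0 - p0 - a)\<close>, a fixed point of
    \<open>T\<close> plus a fixed vector of \<open>L\<close>, while \<open>x0 - p = a\<close> stays
    in the closed range of \<open>Id - L\<close>.\<close>
  define p where "p = x0 - a"
  have p: "T p = p"
    using shift[OF p0, of "x0 - p0 - a"] a(2) unfolding p_def by (simp add: algebra_simps)
  have "metric_proj S x0 = p"
  proof (rule metric_proj_eqI)
    show "p \<in> S" using p S by simp
    fix c assume "c \<in> S"
    \<comment> \<open>Differences of minimizers are fixed by \<open>L\<close>, hence orthogonal to
      \<open>a = x0 - p\<close>.\<close>
    then have "p + L (c - p) = p + (c - p)" using shift[OF p, of "c - p"] S by simp
    then have "L (c - p) = c - p" by (rule add_left_imp_eq)
    then have "a \<bullet> (c - p) = 0"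
      by (rule fixed_orthogonal_closure_range[OF L norm_L _ a(1)])
    then show "(x0 - p) \<bullet> (c - p) \<le> 0" unfolding p_def by simp
  qed
  moreover have "x \<longlonglongrightarrow> p"
  proof -
    have "fista_sequences L t a (\<lambda>n. x n - p) (\<lambda>n. y n - p)"
      using fista_sequences_translate[OF seq shift[OF p]] unfolding p_def by simp
    from L bound asym a(1) this have "(\<lambda>n. x n - p) \<longlonglongrightarrow> 0"
      by (rule fista_linear_tendsto_0)
    then show ?thesis by (rule LIM_zero_cancel)
  qed
  moreover from this have "y \<longlonglongrightarrow> p" by (rule fista_sequences_y_tendsto[OF t seq])
  ultimately show ?thesis by simp
qed

end
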